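(* Let $q=3^d$ with $d$ even, let $\beta$ be a fixed primitive root of $\mathbb{F}_q^\times$ (a generator of the multiplicative group), and let $\alpha\in\mathbb{F}_q$ be a fixed element with $\operatorname{Tr}(\alpha)=1$. Let $E\colon y^2=x^3+a_4x+a_6$ be an elliptic curve over $\mathbb{F}_q$ of Type II, i.e. such that $-a_4\in\mathbb{F}_q^\times$ is a square but not a fourth power in $\mathbb{F}_q^\times$. Then there exists $u\in\mathbb{F}_q^\times$ with $u^4=\beta^2(-a_4)^{-1}$, and $E$ is isomorphic over $\mathbb{F}_q$ to $E_b\colon y^2=x^3-\beta^2x+b$ with $b=u^6a_6$; every elliptic curve $y^2=x^3+a_4'x+a_6'$ isomorphic to $E$ over $\mathbb{F}_q$ is also of Type II. Moreover, the curves $E_b\colon y^2=x^3-\beta^2x+b$, $b\in\mathbb{F}_q$, form exactly two $\mathbb{F}_q$-isomorphism classes: (i) if $\operatorname{Tr}(b\beta^{-3})=0$, then $E_b$ is isomorphic to $E_0$; (ii) if $\operatorname{Tr}(b\beta^{-3})\neq0$, then $E_b$ is isomorphic to $E_{\alpha\beta^3}$.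
   Context: $\operatorname{Tr}$ denotes the trace map $\mathbb{F}_q\to\mathbb{F}_3$. In characteristic $3$, every supersingular elliptic curve over $\mathbb{F}_q$ can be written as $y^2=x^3+a_4x+a_6$ with $a_4\neq0$. *)

theory Defs
  imports "HOL-Algebra.Algebraic_Closure_Type" "HOL-Library.Cardinality"
begin

text \<open>
  The absolute trace of a field with \<open>3 ^ d\<close> elements, as the sum of the Galois conjugates. The
  target, the field with three elements, is identified with the prime subfield \<open>{0, 1, -1}\<close>.
\<close>

definition trace3 :: "nat \<Rightarrow> 'a::field \<Rightarrow> 'a" where
  "trace3 d x = (\<Sum>i<d. x ^ (3 ^ i))"

definition primitive_root :: "'a::field \<Rightarrow> bool" where
  "primitive_root \<beta> \<longleftrightarrow> range (\<lambda>n::nat. \<beta> ^ n) = UNIV - {0}"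


subsection \<open>Plane projective curves and elliptic curves\<close>

text \<open>
  The pair \<open>(a4, a6)\<close> stands for the projective curve \<open>y\<^sup>2 z = x\<^sup>3 + a4 x z\<^sup>2 + a6 z\<^sup>3\<close>. Points are
  taken over the algebraic closure and are given by nonzero homogeneous coordinate triples,
  up to \<open>proj_eq\<close>.
\<close>

type_synonym 'a curve = "'a \<times> 'a"
type_synonym 'a triple = "'a \<times> 'a \<times> 'a"

fun scale :: "'k::field \<Rightarrow> 'k triple \<Rightarrow> 'k triple" where
  "scale c (x, y, z) = (c * x, c * y, c * z)"

definition proj_eq :: "'k::field triple \<Rightarrow> 'k triple \<Rightarrow> bool" where
  "proj_eq P Q \<longleftrightarrow> (\<exists>c. c \<noteq> 0 \<and> Q = scale c P)"

definition points :: "'a::field curve \<Rightarrow> 'a alg_closure triple set" where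
  "points = (\<lambda>(a4, a6). {(x, y, z). (x, y, z) \<noteq> (0, 0, 0) \<and>
     y ^ 2 * z = x ^ 3 + to_ac a4 * x * z ^ 2 + to_ac a6 * z ^ 3})"

definition base_point :: "'k::field triple" where
  "base_point = (0, 1, 0)"

text \<open>
  Smoothness: the three partial derivatives of
  \<open>x\<^sup>3 + a4 x z\<^sup>2 + a6 z\<^sup>3 - y\<^sup>2 z\<close> have no common zero on the curve.
\<close>

definition elliptic_curve :: "'a::field curve \<Rightarrow> bool" where
  "elliptic_curve = (\<lambda>(a4, a6). \<forall>(x, y, z) \<in> points (a4, a6).
     (3 * x ^ 2 + to_ac a4 * z ^ 2,
      - (2 * y * z),
      2 * to_ac a4 * x * z + 3 * to_ac a6 * z ^ 2 - y ^ 2) \<noteq> (0, 0, 0))"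

lemma elliptic_curve_char3:
  fixes a4 a6 :: "'a::field"
  assumes "(3::'a) = 0"
  shows "elliptic_curve (a4, a6) \<longleftrightarrow> a4 \<noteq> 0"
proof -
  have three: "(3 :: 'a alg_closure) = 0"
  proof -
    have "to_ac (1+1+1 :: 'a) = 0" using assms by (simp add: numeral_3_eq_3 del: to_ac_add)
    then show ?thesis by simp
  qed
  show ?thesis
  proof
    assume a: "a4 \<noteq> 0"
    show "elliptic_curve (a4, a6)"
      using a three unfolding elliptic_curve_def points_def
      by auto
  next
    assume e: "elliptic_curve (a4, a6)"
    show "a4 \<noteq> 0"
    proof
      assume "a4 = 0"
      obtain x :: "'a alg_closure" where x: "x ^ 3 = - to_ac a6"
        using nth_root_exists[of 3 "- to_ac a6"] by auto
      have "(x, 0, 1) \<in> points (a4, a6)" using x \<open>a4 = 0\<close> by (simp add: points_def)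
      then show False using e \<open>a4 = 0\<close> three unfolding elliptic_curve_def by fastforce
    qed
  qed
qed


subsection \<open>Isomorphism over the ground field\<close>

text \<open>
  Value of the form of degree \<open>n\<close> over the ground field in which \<open>c i j\<close> is the coefficient of
  \<open>x\<^sup>i y\<^sup>j z\<^bsup>n - i - j\<^esup>\<close>.
\<close>

fun form :: "nat \<Rightarrow> (nat \<Rightarrow> nat \<Rightarrow> 'a::field) \<Rightarrow> 'a alg_closure triple \<Rightarrow> 'a alg_closure" where
  "form n c (x, y, z) = (\<Sum>i\<le>n. \<Sum>j\<le>n - i. to_ac (c i j) * x ^ i * y ^ j * z ^ (n - i - j))"

text \<open>
  A morphism over the ground field: near every geometric point it is given by three forms over
  the ground field of equal degree without common zero at the point. Taking \<open>Q\<close> below to be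
  a multiple of \<open>P\<close> shows that \<open>\<phi>\<close> respects \<open>proj_eq\<close>.
\<close>

definition curve_morphism ::
    "'a::field curve \<Rightarrow> 'a curve \<Rightarrow> ('a alg_closure triple \<Rightarrow> 'a alg_closure triple) \<Rightarrow> bool" where
  "curve_morphism E E' \<phi> \<longleftrightarrow>
     (\<forall>P \<in> points E. \<phi> P \<in> points E' \<and>
       (\<exists>n f g h. (form n f P, form n g P, form n h P) \<noteq> (0, 0, 0) \<and>
         (\<forall>Q \<in> points E. (form n f Q, form n g Q, form n h Q) \<noteq> (0, 0, 0) \<longrightarrow>
            proj_eq (\<phi> Q) (form n f Q, form n g Q, form n h Q))))"

definition isomorphic_curves :: "'a::field curve \<Rightarrow> 'a curve \<Rightarrow> bool" where
  "isomorphic_curves E E' \<longleftrightarrow>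
     (\<exists>\<phi> \<psi>. curve_morphism E E' \<phi> \<and> curve_morphism E' E \<psi> \<and>
        (\<forall>P \<in> points E. proj_eq (\<psi> (\<phi> P)) P) \<and>
        (\<forall>P \<in> points E'. proj_eq (\<phi> (\<psi> P)) P) \<and>
        proj_eq (\<phi> base_point) base_point)"


subsection \<open>Type II\<close>

definition type_II :: "'a::field curve \<Rightarrow> bool" where
  "type_II = (\<lambda>(a4, a6). - a4 \<noteq> 0 \<and>
     (\<exists>s. s \<noteq> 0 \<and> s ^ 2 = - a4) \<and> \<not> (\<exists>s. s \<noteq> 0 \<and> s ^ 4 = - a4))"

end

theory Submission
  imports Defs
begin

text \<open>
  Curves are told apart by counting points over the ground field, which an isomorphism preserves;
  the general form of a change of variables is never needed. With the quadratic character \<open>\<chi>\<close>,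
  the number of affine points is \<open>q + A\<close> with \<open>A = (\<Sum>x. \<chi> (x\<^sup>3 + a4 x + a6))\<close>. If \<open>- a4\<close> is not
  a square, the additive map \<open>x \<mapsto> x\<^sup>3 + a4 x\<close> is bijective and \<open>A = 0\<close>. If \<open>- a4 = s\<^sup>2\<close>,
  substituting \<open>x = s z\<close> and using that \<open>z\<^sup>3 - z\<close> takes every value of trace 0 exactly three times
  gives \<open>A = 3 \<chi>(s) S(Tr (a6 / s\<^sup>3))\<close>, where \<open>S t\<close> is the sum of \<open>\<chi>\<close> over the elements of
  trace \<open>t\<close>. As \<open>- 1\<close> is a square, \<open>S (- 1) = S 1\<close>, hence \<open>S 0 = - 2 S 1\<close>; and \<open>S 1\<close> is odd.
  So \<open>A / (3 S 1)\<close> is 2 or -1 for type II, -2 or 1 if \<open>- a4\<close> is a fourth power, and 0 otherwise.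
\<close>

subsection \<open>Rational points\<close>

lemma proj_eq_refl: "proj_eq P P"
  unfolding proj_eq_def by (rule exI[of _ 1], cases P) auto

lemma proj_eq_sym:
  assumes "proj_eq P Q"
  shows "proj_eq Q P"
proof -
  obtain c where "c \<noteq> 0" "Q = scale c P" using assms unfolding proj_eq_def by blast
  then show ?thesis unfolding proj_eq_def
    by (intro exI[of _ "inverse c"], cases P) (auto simp: mult.assoc[symmetric])
qed

lemma proj_eq_trans:
  assumes "proj_eq P Q" "proj_eq Q R"
  shows "proj_eq P R"
proof -
  obtain c where "c \<noteq> 0" "Q = scale c P" using assms unfolding proj_eq_def by blast
  moreover obtain e where "e \<noteq> 0" "R = scale e Q" using assms unfolding proj_eq_def by blast
  ultimately show ?thesis unfolding proj_eq_def
    by (intro exI[of _ "e * c"], cases P) (auto simp: mult.assoc)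
qed

lemma form_scale: "form n c (scale k P) = k ^ n * form n c P"
proof (cases P)
  case (fields x y z)
  have "to_ac (c i j) * (k * x) ^ i * (k * y) ^ j * (k * z) ^ (n - i - j) =
      k ^ n * (to_ac (c i j) * x ^ i * y ^ j * z ^ (n - i - j))" if "i \<le> n" "j \<le> n - i" for i j
  proof -
    have "n = i + j + (n - i - j)" using that by simp
    then have "k ^ n = k ^ i * k ^ j * k ^ (n - i - j)" by (metis power_add)
    then show ?thesis by (simp add: power_mult_distrib)
  qed
  then show ?thesis unfolding fields form.simps scale.simps sum_distrib_left
    by (intro sum.cong refl) simp
qed

text \<open>The forms chosen at P share one degree n, so at a multiple cP their values are all
  multiplied by c^n and still do not vanish together. One choice of forms therefore describes both
  images.\<close>

lemma curve_morphism_proj_eq: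
  assumes m: "curve_morphism E E' \<phi>" and P: "P \<in> points E" and Q: "Q \<in> points E"
    and PQ: "proj_eq P Q"
  shows "proj_eq (\<phi> P) (\<phi> Q)"
proof -
  obtain n f g h where nz: "(form n f P, form n g P, form n h P) \<noteq> (0, 0, 0)"
    and eq: "\<And>Q. Q \<in> points E \<Longrightarrow> (form n f Q, form n g Q, form n h Q) \<noteq> (0, 0, 0) \<Longrightarrow>
            proj_eq (\<phi> Q) (form n f Q, form n g Q, form n h Q)"
    using m P unfolding curve_morphism_def by blast
  obtain c where c: "c \<noteq> 0" "Q = scale c P" using PQ unfolding proj_eq_def by blast
  have *: "(form n f Q, form n g Q, form n h Q) = scale (c ^ n) (form n f P, form n g P, form n h P)"
    unfolding c(2) by (simp add: form_scale)
  then have "(form n f Q, form n g Q, form n h Q) \<noteq> (0, 0, 0)" using nz c(1) by auto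
  then have "proj_eq (\<phi> Q) (form n f Q, form n g Q, form n h Q)" using eq Q by blast
  moreover have "proj_eq (form n f P, form n g P, form n h P) (form n f Q, form n g Q, form n h Q)"
    unfolding proj_eq_def * by (rule exI[of _ "c ^ n"]) (use c in simp)
  ultimately show ?thesis using eq[OF P nz] by (blast intro: proj_eq_trans proj_eq_sym)
qed

section \<open>Points with coordinates in the ground field\<close>

fun to_ac_triple :: "'a::field triple \<Rightarrow> 'a alg_closure triple" where
  "to_ac_triple (x, y, z) = (to_ac x, to_ac y, to_ac z)"

definition affine_points :: "'a::field curve \<Rightarrow> ('a \<times> 'a) set" where
  "affine_points = (\<lambda>(a4, a6). {(x, y). y ^ 2 = x ^ 3 + a4 * x + a6})"

text \<open>Normalised triples: \<open>z = 0\<close> on the curve forces \<open>x = 0\<close>, and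
  any other rational point has a unique representative with \<open>z = 1\<close>. Counting triples
  thus counts projective points.\<close>

definition rational_points :: "'a::field curve \<Rightarrow> 'a triple set" where
  "rational_points E = insert base_point ((\<lambda>(x, y). (x, y, 1)) ` affine_points E)"

lemma rational_points_unique:
  assumes "r \<in> rational_points E" "r' \<in> rational_points E"
    and "proj_eq (to_ac_triple r) (to_ac_triple r')"
  shows "r = r'"
  using assms by (auto simp: rational_points_def base_point_def proj_eq_def)

lemma to_ac_triple_in_points:
  assumes "r \<in> rational_points E"
  shows "to_ac_triple r \<in> points E"
proof -
  obtain a4 a6 where E: "E = (a4, a6)" by (cases E)
  have "to_ac y ^ 2 = to_ac x ^ 3 + to_ac a4 * to_ac x + to_ac a6"
    if "y ^ 2 = x ^ 3 + a4 * x + a6" for x y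
    using arg_cong[OF that, of to_ac] by simp
  then show ?thesis using assms
    by (auto simp: rational_points_def base_point_def affine_points_def points_def E)
qed

text \<open>Multiplying the equation of P by c^3 gives the equation of the proportional triple p. It
  descends to the ground field because \<open>to_ac\<close> is injective, and p is normalised
  there.\<close>

lemma rational_representative:
  assumes P: "P \<in> points E" and eq: "proj_eq P (to_ac_triple p)"
  obtains r where "r \<in> rational_points E" "proj_eq P (to_ac_triple r)"
proof -
  obtain a4 a6 where E: "E = (a4, a6)" by (cases E)
  obtain x y z where p: "p = (x, y, z)" by (cases p)
  obtain c where c: "c \<noteq> 0" "to_ac_triple p = scale c P" using eq unfolding proj_eq_def by blast
  obtain x' y' z' where P_eq: "P = (x', y', z')" by (cases P)
  have cs: "to_ac x = c * x'" "to_ac y = c * y'" "to_ac z = c * z'"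
    using c p P_eq by auto
  have nz: "(x, y, z) \<noteq> (0, 0, 0)" using P c cs by (auto simp: points_def E P_eq)
  have "y' ^ 2 * z' = x' ^ 3 + to_ac a4 * x' * z' ^ 2 + to_ac a6 * z' ^ 3"
    using P by (auto simp: points_def E P_eq)
  then have "c ^ 3 * (y' ^ 2 * z') = c ^ 3 * (x' ^ 3 + to_ac a4 * x' * z' ^ 2 + to_ac a6 * z' ^ 3)"
    by simp
  then have "to_ac (y ^ 2 * z) = to_ac (x ^ 3 + a4 * x * z ^ 2 + a6 * z ^ 3)"
    by (simp add: cs algebra_simps power2_eq_square power3_eq_cube)
  then have on: "y ^ 2 * z = x ^ 3 + a4 * x * z ^ 2 + a6 * z ^ 3" by (simp only: to_ac_eq_iff)
  show ?thesis
  proof (cases "z = 0")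
    case True
    then have "x = 0" using on by simp
    then have "y \<noteq> 0" using nz True by simp
    then have "proj_eq (to_ac_triple p) (to_ac_triple base_point)" unfolding proj_eq_def
      by (intro exI[of _ "inverse (to_ac y)"]) (simp add: p base_point_def True \<open>x = 0\<close>)
    then show ?thesis using that[of base_point] proj_eq_trans[OF eq]
      by (auto simp: rational_points_def)
  next
    case False
    have "(y / z) ^ 2 = (y ^ 2 * z) / z ^ 3"
      by (simp add: False eval_nat_numeral)
    also have "\<dots> = (x / z) ^ 3 + a4 * (x / z) + a6"
      unfolding on by (simp add: False add_divide_distrib power_divide eval_nat_numeral)
    finally have "(x / z, y / z) \<in> affine_points E"
      by (simp add: affine_points_def E)
    then have "(x / z, y / z, 1) \<in> rational_points E"
      unfolding rational_points_def by (auto intro!: rev_image_eqI)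
    moreover have "proj_eq (to_ac_triple p) (to_ac_triple (x / z, y / z, 1))"
      unfolding proj_eq_def
      by (intro exI[of _ "inverse (to_ac z)"]) (simp add: p False divide_inverse mult.commute)
    ultimately show ?thesis using that proj_eq_trans[OF eq] by blast
  qed
qed

text \<open>The forms defining a morphism have coefficients in the ground field.\<close>

lemma curve_morphism_rational:
  assumes m: "curve_morphism E E' \<phi>" and r: "r \<in> rational_points E"
  obtains r' where "r' \<in> rational_points E'" "proj_eq (\<phi> (to_ac_triple r)) (to_ac_triple r')"
proof -
  let ?P = "to_ac_triple r"
  have P: "?P \<in> points E" using r by (rule to_ac_triple_in_points)
  obtain n f g h where nz: "(form n f ?P, form n g ?P, form n h ?P) \<noteq> (0, 0, 0)"
    and eq: "\<And>Q. Q \<in> points E \<Longrightarrow> (form n f Q, form n g Q, form n h Q) \<noteq> (0, 0, 0) \<Longrightarrow>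
            proj_eq (\<phi> Q) (form n f Q, form n g Q, form n h Q)"
    using m P unfolding curve_morphism_def by blast
  have "\<exists>v. form n c ?P = to_ac v" for c
    by (cases r) (auto simp flip: to_ac_power to_ac_mult to_ac_sum)
  then obtain x y z where "form n f ?P = to_ac x" "form n g ?P = to_ac y" "form n h ?P = to_ac z"
    by metis
  then have "proj_eq (\<phi> ?P) (to_ac_triple (x, y, z))" using eq[OF P nz] by simp
  moreover have "\<phi> ?P \<in> points E'" using m P unfolding curve_morphism_def by blast
  ultimately show ?thesis using rational_representative that by metis
qed

text \<open>The map induced by \<phi> on normalised triples is injective: \<psi> undoes \<phi> up to
  scaling, and proportional normalised triples are equal.\<close>

lemma card_rational_points_le:
  fixes E E' :: "'a::{field,finite} curve"
  assumes m: "curve_morphism E E' \<phi>" and m': "curve_morphism E' E \<psi>"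
    and inv: "\<And>P. P \<in> points E \<Longrightarrow> proj_eq (\<psi> (\<phi> P)) P"
  shows "card (rational_points E) \<le> card (rational_points E')"
proof -
  have "\<forall>r\<in>rational_points E. \<exists>r'. r' \<in> rational_points E' \<and>
      proj_eq (\<phi> (to_ac_triple r)) (to_ac_triple r')"
    using curve_morphism_rational[OF m] by metis
  then obtain \<Phi> where \<Phi>: "\<And>r. r \<in> rational_points E \<Longrightarrow> \<Phi> r \<in> rational_points E'"
    "\<And>r. r \<in> rational_points E \<Longrightarrow> proj_eq (\<phi> (to_ac_triple r)) (to_ac_triple (\<Phi> r))"
    by metis
  have "inj_on \<Phi> (rational_points E)"
  proof (rule inj_onI)
    fix r s assume r: "r \<in> rational_points E" and s: "s \<in> rational_points E" and "\<Phi> r = \<Phi> s"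
    then have "proj_eq (\<phi> (to_ac_triple r)) (\<phi> (to_ac_triple s))"
      using \<Phi>(2) by (metis proj_eq_sym proj_eq_trans)
    moreover have P: "to_ac_triple r \<in> points E" "to_ac_triple s \<in> points E"
      using r s to_ac_triple_in_points by blast+
    moreover have "\<phi> (to_ac_triple r) \<in> points E'" "\<phi> (to_ac_triple s) \<in> points E'"
      using P m unfolding curve_morphism_def by blast+
    ultimately have "proj_eq (\<psi> (\<phi> (to_ac_triple r))) (\<psi> (\<phi> (to_ac_triple s)))"
      using curve_morphism_proj_eq[OF m'] by blast
    then have "proj_eq (to_ac_triple r) (to_ac_triple s)"
      using inv P by (meson proj_eq_sym proj_eq_trans)
    then show "r = s" using rational_points_unique r s by blast
  qed
  then show ?thesis using \<Phi>(1) by (intro card_inj_on_le[of \<Phi>]) auto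
qed

lemma card_rational_points:
  fixes E :: "'a::{field,finite} curve"
  shows "card (rational_points E) = Suc (card (affine_points E))"
  unfolding rational_points_def
  by (subst card_insert_disjoint)
    (auto simp: base_point_def split_beta intro!: card_image inj_onI prod_eqI)

lemma isomorphic_card_affine_points:
  fixes E E' :: "'a::{field,finite} curve"
  assumes "isomorphic_curves E E'"
  shows "card (affine_points E) = card (affine_points E')"
proof -
  have "card (rational_points E) = card (rational_points E')"
    using assms card_rational_points_le unfolding isomorphic_curves_def by (metis le_antisym)
  then show ?thesis by (simp add: card_rational_points)
qed


subsection \<open>Changes of variables\<close>

fun weierstrass_map :: "'k::field \<Rightarrow> 'k \<Rightarrow> 'k triple \<Rightarrow> 'k triple" where
  "weierstrass_map u r (x, y, z) = (u ^ 2 * x + r * z, u ^ 3 * y, z)"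

text \<open>In characteristic 3 the shift by r creates no term in x^2, since the mixed terms of the
  cube carry the factor 3. The short equation therefore keeps its shape.\<close>

lemma weierstrass_identity:
  fixes u r a b x y z :: "'k::field"
  assumes three: "(3::'k) = 0" and on: "y ^ 2 * z = x ^ 3 + a * x * z ^ 2 + b * z ^ 3"
  shows "(u ^ 3 * y) ^ 2 * z = (u ^ 2 * x + r * z) ^ 3 + u ^ 4 * a * (u ^ 2 * x + r * z) * z ^ 2
    + (u ^ 6 * b - r ^ 3 - u ^ 4 * a * r) * z ^ 3"
proof -
  have "(u ^ 3 * y) ^ 2 * z = u ^ 6 * (y ^ 2 * z)"
    by (simp add: power_mult_distrib flip: power_mult)
  also have "\<dots> = (u ^ 2 * x + r * z) ^ 3 + u ^ 4 * a * (u ^ 2 * x + r * z) * z ^ 2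
    + (u ^ 6 * b - r ^ 3 - u ^ 4 * a * r) * z ^ 3 - 3 * (u ^ 2 * x * (r * z) * (u ^ 2 * x + r * z))"
    unfolding on by (simp add: eval_nat_numeral algebra_simps)
  finally show ?thesis by (simp add: three)
qed

lemma curve_morphism_weierstrass_map:
  fixes u r :: "'a::field"
  assumes three: "(3::'a) = 0" and u: "u \<noteq> 0"
    and a4: "a4' = u ^ 4 * a4" and a6: "a6' = u ^ 6 * a6 - r ^ 3 - u ^ 4 * a4 * r"
  shows "curve_morphism (a4, a6) (a4', a6') (weierstrass_map (to_ac u) (to_ac r))"
proof -
  let ?\<phi> = "weierstrass_map (to_ac u) (to_ac r)"
  have three': "(3::'a alg_closure) = 0" using three by (metis to_ac_numeral to_ac_0)
  \<comment> \<open>Coefficients of the linear forms u^2 x + r z, u^3 y and z; in degree 1 the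
    indices i = j = 0 leave exponent 1 for z.\<close>
  define f where "f = (\<lambda>(i::nat) (j::nat). if i = 1 \<and> j = 0 then u ^ 2 else if i = 0 \<and> j = 0 then r else 0)"
  define g where "g = (\<lambda>(i::nat) (j::nat). if i = 0 \<and> j = 1 then u ^ 3 else 0)"
  define h where "h = (\<lambda>(i::nat) (j::nat). if i = 0 \<and> j = 0 then 1::'a else 0)"
  have forms: "(form 1 f P, form 1 g P, form 1 h P) = ?\<phi> P" for P
    by (cases P) (simp add: f_def g_def h_def)
  have "?\<phi> P \<in> points (a4', a6')" if P: "P \<in> points (a4, a6)" for P
  proof -
    obtain x y z where xyz: "P = (x, y, z)" by (cases P)
    have nz: "(x, y, z) \<noteq> (0, 0, 0)"
      and on: "y ^ 2 * z = x ^ 3 + to_ac a4 * x * z ^ 2 + to_ac a6 * z ^ 3"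
      using P by (auto simp: points_def xyz)
    have "(to_ac u ^ 3 * y) ^ 2 * z = (to_ac u ^ 2 * x + to_ac r * z) ^ 3
        + to_ac a4' * (to_ac u ^ 2 * x + to_ac r * z) * z ^ 2 + to_ac a6' * z ^ 3"
      using weierstrass_identity[OF three' on] by (simp add: a4 a6)
    then show ?thesis using nz u by (auto simp: points_def xyz)
  qed
  moreover have "?\<phi> P \<noteq> (0, 0, 0)" if "P \<in> points (a4, a6)" for P
    using calculation[OF that] by (auto simp: points_def)
  ultimately show ?thesis unfolding curve_morphism_def
    by (intro ballI conjI exI[of _ 1] exI[of _ f] exI[of _ g] exI[of _ h])
      (simp_all only: forms not_False_eq_True proj_eq_refl simp_thms)
qed

text \<open>Solving x' = u^2 x + r z for x gives x = u^(-2) x' - (r / u^2) z, a map of the same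
  kind.\<close>

lemma weierstrass_map_inverse:
  assumes "u \<noteq> 0"
  shows "weierstrass_map (inverse u) (- r / u ^ 2) (weierstrass_map u r P) = P"
    and "weierstrass_map u r (weierstrass_map (inverse u) (- r / u ^ 2) P) = P"
  using assms by (cases P; simp add: field_simps)+

lemma isomorphic_curvesI:
  fixes u r :: "'a::field"
  assumes three: "(3::'a) = 0" and u: "u \<noteq> 0"
    and a4: "a4' = u ^ 4 * a4" and a6: "a6' = u ^ 6 * a6 - r ^ 3 - u ^ 4 * a4 * r"
  shows "isomorphic_curves (a4, a6) (a4', a6')"
proof -
  let ?\<phi> = "weierstrass_map (to_ac u) (to_ac r)"
  let ?\<psi> = "weierstrass_map (to_ac (inverse u)) (to_ac (- r / u ^ 2))"
  have "curve_morphism (a4, a6) (a4', a6') ?\<phi>"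
    using assms by (rule curve_morphism_weierstrass_map)
  moreover have "curve_morphism (a4', a6') (a4, a6) ?\<psi>"
    using u by (intro curve_morphism_weierstrass_map three)
      (simp_all add: a4 a6 field_simps)
  moreover have "?\<psi> (?\<phi> P) = P" "?\<phi> (?\<psi> P) = P" for P
    using weierstrass_map_inverse[of "to_ac u" "to_ac r"] u by simp_all
  moreover have "proj_eq (?\<phi> base_point) base_point"
    unfolding proj_eq_def base_point_def
    by (rule exI[of _ "inverse (to_ac u) ^ 3"]) (simp add: u flip: power_mult_distrib)
  ultimately show ?thesis unfolding isomorphic_curves_def
    by (intro exI[of _ ?\<phi>] exI[of _ ?\<psi>]) (simp add: proj_eq_refl)
qed


subsection \<open>The quadratic character and the trace\<close>

text \<open>Translation by 1 permutes the field, so adding 1 to every element leaves the sum of all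
  elements unchanged.\<close>

lemma of_nat_CARD_eq_0: "of_nat CARD('a) = (0::'a::{field,finite})"
proof -
  have "(\<Sum>x\<in>UNIV. x + 1) = (\<Sum>x\<in>UNIV. x::'a)"
    by (rule sum.reindex_bij_witness[of _ "\<lambda>x. x - 1" "\<lambda>x. x + 1"]) auto
  then show ?thesis by (simp add: sum.distrib)
qed

text \<open>Multiplication by a nonzero x permutes the nonzero elements; cancelling their product
  gives x^(q-1) = 1.\<close>

lemma power_CARD: "x ^ CARD('a) = (x::'a::{field,finite})"
proof (cases "x = 0")
  case False
  let ?N = "UNIV - {0::'a}"
  have "(\<Prod>y\<in>?N. x * y) = (\<Prod>y\<in>?N. y)"
    by (rule prod.reindex_bij_witness[of _ "\<lambda>y. y / x" "\<lambda>y. x * y"]) (use False in auto)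
  then have "x ^ card ?N = 1" by (simp add: prod.distrib)
  moreover have "CARD('a) = Suc (card ?N)" by (rule card_Suc_Diff1[symmetric]) auto
  ultimately show ?thesis by (simp only: power_Suc mult_1_right)
qed simp

definition quad_char :: "'a::field \<Rightarrow> int" where
  "quad_char w = (if w = 0 then 0 else if \<exists>y. w = y ^ 2 then 1 else -1)"

lemma quad_char_square: "x \<noteq> 0 \<Longrightarrow> quad_char (x ^ 2) = 1"
  by (auto simp: quad_char_def)

lemma card_square_roots:
  fixes w :: "'a::{field,finite}"
  assumes "(2::'a) \<noteq> 0"
  shows "int (card {y. y ^ 2 = w}) = 1 + quad_char w"
proof (cases "\<exists>y. w = y ^ 2")
  case True
  then obtain v where v: "w = v ^ 2" by blast
  have "{y. y ^ 2 = w} = {v, - v}" unfolding v by (auto simp: power2_eq_iff)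
  moreover have "v = - v \<longleftrightarrow> v = 0"
  proof
    assume "v = - v"
    then have "v + v = 0" by (simp add: eq_neg_iff_add_eq_0)
    then have "2 * v = 0" by simp
    then show "v = 0" using assms by simp
  qed simp
  ultimately show ?thesis by (cases "v = 0") (auto simp: quad_char_def v)
next
  case False
  then have "{y. y ^ 2 = w} = {}" by auto
  moreover have "w \<noteq> 0" using False by (metis zero_power2)
  ultimately show ?thesis using False by (simp add: quad_char_def del: Collect_empty_eq)
qed

text \<open>By the point count below, this is minus the trace of Frobenius when the curve is
  elliptic and q is odd.\<close>

definition char_sum :: "'a::{field,finite} \<Rightarrow> 'a \<Rightarrow> int" where
  "char_sum a4 a6 = (\<Sum>x\<in>UNIV. quad_char (x ^ 3 + a4 * x + a6))"

lemma card_affine_points: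
  fixes a4 a6 :: "'a::{field,finite}"
  assumes "(2::'a) \<noteq> 0"
  shows "int (card (affine_points (a4, a6))) = int CARD('a) + char_sum a4 a6"
proof -
  have "affine_points (a4, a6) = Sigma UNIV (\<lambda>x. {y. y ^ 2 = x ^ 3 + a4 * x + a6})"
    by (auto simp: affine_points_def)
  then have "int (card (affine_points (a4, a6))) =
      (\<Sum>x\<in>UNIV. int (card {y. y ^ 2 = x ^ 3 + a4 * x + a6}))"
    by (simp add: card_SigmaI)
  then show ?thesis by (simp add: card_square_roots[OF assms] sum.distrib char_sum_def)
qed

section \<open>Arithmetic in characteristic 3 and the trace\<close>

locale char3_field =
  fixes d :: nat and \<alpha> \<beta> :: "'a::{field,finite}"
  assumes card_field: "CARD('a) = 3 ^ d" and even_degree: "even d"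
    and primitive: "primitive_root \<beta>" and trace_\<alpha>: "trace3 d \<alpha> = 1"
begin

abbreviation Tr :: "'a \<Rightarrow> 'a" where "Tr \<equiv> trace3 d"

lemma three_eq_0: "(3::'a) = 0"
  using of_nat_CARD_eq_0[where 'a = 'a] by (simp add: card_field)

lemma degree_pos: "d > 0"
  \<comment> \<open>For \<open>d = 0\<close> the trace would be an empty sum, which is not
    1.\<close>
  using trace_\<alpha> by (cases d) (auto simp: trace3_def)

lemma two_neq_0: "(2::'a) \<noteq> 0"
proof
  assume "(2::'a) = 0"
  then have "(3::'a) - 2 = 0" using three_eq_0 by simp
  then show False by simp
qed

lemma one_neq_minus_one: "(1::'a) \<noteq> - 1" "(- 1::'a) \<noteq> 1"
  using two_neq_0 by (metis add.right_inverse one_add_one)+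

lemma cube_add: "(x + y) ^ 3 = x ^ 3 + (y::'a) ^ 3"
proof -
  have "(x + y) ^ 3 = x ^ 3 + y ^ 3 + 3 * (x * y * (x + y))"
    by (simp add: algebra_simps power3_eq_cube)
  then show ?thesis by (simp add: three_eq_0)
qed

lemma cube_diff: "(x - y) ^ 3 = x ^ 3 - (y::'a) ^ 3"
  using cube_add[of "x - y" y] by simp

lemma power_3_power_add: "(x + y) ^ (3 ^ i) = x ^ (3 ^ i) + (y::'a) ^ (3 ^ i)"
  by (induction i) (simp_all add: power_mult cube_add mult.commute[of 3])

lemma Tr_add: "Tr (x + y) = Tr x + Tr y"
  by (simp add: trace3_def power_3_power_add sum.distrib)

lemma Tr_0 [simp]: "Tr 0 = 0"
  by (simp add: trace3_def power_0_left)

lemma Tr_minus: "Tr (- x) = - Tr x"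
  using Tr_add[of x "- x"] by (simp add: eq_neg_iff_add_eq_0 add.commute)

lemma Tr_diff: "Tr (x - y) = Tr x - Tr y"
  using Tr_add[of x "- y"] by (simp add: Tr_minus)

text \<open>Cubing shifts the conjugates cyclically, because x^(3^d) = x.\<close>

lemma Tr_cube: "Tr (x ^ 3) = Tr x"
proof -
  have "x + (\<Sum>i<d. x ^ (3 ^ Suc i)) = (\<Sum>i<Suc d. x ^ (3 ^ i))"
    by (simp only: sum.lessThan_Suc_shift power_0 power_one_right)
  also have "\<dots> = Tr x + x"
    using power_CARD[of x] by (simp add: trace3_def card_field)
  finally show ?thesis by (simp add: trace3_def flip: power_mult)
qed

text \<open>The trace is fixed by cubing, hence a root of X^3 - X = X (X - 1) (X + 1).\<close>

lemma Tr_cases: "Tr x = 0 \<or> Tr x = 1 \<or> Tr x = - 1"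
proof -
  have "(\<Sum>i\<in>I. f i) ^ 3 = (\<Sum>i\<in>I. f i ^ 3)" if "finite I" for I and f :: "nat \<Rightarrow> 'a"
    using that by (induction I) (auto simp: cube_add)
  then have "Tr x ^ 3 = Tr (x ^ 3)"
    by (simp add: trace3_def mult.commute flip: power_mult)
  then have "Tr x ^ 3 = Tr x" by (simp only: Tr_cube)
  then have "Tr x * (Tr x - 1) * (Tr x + 1) = 0"
    by (simp add: algebra_simps power3_eq_cube)
  then show ?thesis
    by (simp only: mult_eq_0_iff right_minus_eq eq_neg_iff_add_eq_0) blast
qed

lemma sum_by_trace:
  fixes f :: "'a \<Rightarrow> 'b::comm_monoid_add"
  shows "(\<Sum>x\<in>UNIV. f x) = (\<Sum>x | Tr x = 0. f x) + (\<Sum>x | Tr x = 1. f x) + (\<Sum>x | Tr x = - 1. f x)"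
proof -
  have "UNIV = ({x. Tr x = 0} \<union> {x. Tr x = 1}) \<union> {x. Tr x = - 1}" using Tr_cases by auto
  then have "(\<Sum>x\<in>UNIV. f x) = sum f (({x. Tr x = 0} \<union> {x. Tr x = 1}) \<union> {x. Tr x = - 1})" by simp
  also have "\<dots> = sum f ({x. Tr x = 0} \<union> {x. Tr x = 1}) + (\<Sum>x | Tr x = - 1. f x)"
    by (rule sum.union_disjoint) (use one_neq_minus_one in auto)
  also have "sum f ({x. Tr x = 0} \<union> {x. Tr x = 1}) = (\<Sum>x | Tr x = 0. f x) + (\<Sum>x | Tr x = 1. f x)"
    by (rule sum.union_disjoint) auto
  finally show ?thesis .
qed

text \<open>Translation by v carries the kernel of the trace to the fibre of \<open>Tr v\<close>.
  Translating by \<alpha> and -\<alpha> reaches the values 1 and -1, so the kernel is a third of the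
  field.\<close>

lemma card_trace_fibre: "card {w. Tr w = Tr v} = 3 ^ (d - 1)"
proof -
  have eq: "card {w. Tr w = Tr v} = card {w. Tr w = 0}" for v
    by (rule bij_betw_same_card[of "\<lambda>w. w - v"])
      (rule bij_betw_byWitness[where f' = "\<lambda>w. w + v"], auto simp: Tr_add Tr_diff)
  have "CARD('a) = card {w. Tr w = 0} + card {w. Tr w = 1} + card {w. Tr w = - 1}"
    using sum_by_trace[of "\<lambda>_. 1::nat"] by simp
  moreover have "card {w. Tr w = 1} = card {w. Tr w = 0}" using eq[of \<alpha>] by (simp add: trace_\<alpha>)
  moreover have "card {w. Tr w = - 1} = card {w. Tr w = 0}"
    using eq[of "- \<alpha>"] by (simp add: trace_\<alpha> Tr_minus)
  ultimately have "3 * card {w. Tr w = 0} = 3 ^ d" by (simp add: card_field)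
  also have "\<dots> = 3 * 3 ^ (d - 1)" using degree_pos by (cases d) auto
  finally show ?thesis by (simp add: eq)
qed

section \<open>The Artin-Schreier map\<close>

lemma artin_schreier_eq_iff: "z ^ 3 - z = y ^ 3 - (y::'a) \<longleftrightarrow> z = y \<or> z = y + 1 \<or> z = y - 1"
proof -
  \<comment> \<open>The map is additive, so its fibres are the cosets of its kernel, the prime
    subfield.\<close>
  have "z ^ 3 - z - (y ^ 3 - y) = (z - y) ^ 3 - (z - y)" by (simp add: cube_diff)
  also have "\<dots> = (z - y) * (z - y - 1) * (z - y + 1)"
    by (simp add: algebra_simps power3_eq_cube)
  finally have "z ^ 3 - z - (y ^ 3 - y) = (z - y) * (z - y - 1) * (z - y + 1)" .
  then have "z ^ 3 - z = y ^ 3 - y \<longleftrightarrow> (z - y) * (z - y - 1) * (z - y + 1) = 0"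
    by (simp only: right_minus_eq[of "z ^ 3 - z", symmetric])
  moreover have "z - y + 1 = z - (y - 1)" "z - y - 1 = z - (y + 1)" by simp_all
  ultimately show ?thesis by (simp only: mult_eq_0_iff right_minus_eq) blast
qed

lemma card_artin_schreier_fibre: "card {z. z ^ 3 - z = y ^ 3 - (y::'a)} = 3"
proof -
  have "{z. z ^ 3 - z = y ^ 3 - y} = {y, y + 1, y - 1}" by (auto simp: artin_schreier_eq_iff)
  moreover have "y + 1 \<noteq> y - 1" using one_neq_minus_one by (metis add_left_cancel diff_conv_add_uminus)
  ultimately show ?thesis by simp
qed

text \<open>Additive Hilbert 90 by counting: the image lies in the kernel of the trace because
  conjugates have equal trace, and a map that is three to one has an image of exactly that
  size.\<close>

lemma range_artin_schreier: "range (\<lambda>z. z ^ 3 - z) = {w. Tr w = 0}"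
proof (rule card_subset_eq)
  let ?L = "\<lambda>z::'a. z ^ 3 - z"
  have "CARD('a) = (\<Sum>w\<in>range ?L. card {z. ?L z = w})"
    using sum.group[of "UNIV::'a set" "range ?L" ?L "\<lambda>_. 1::nat"] by simp
  also have "\<dots> = (\<Sum>w\<in>range ?L. 3)"
    by (rule sum.cong) (auto simp: card_artin_schreier_fibre)
  finally have "3 * card (range ?L) = 3 ^ d" by (simp add: card_field)
  also have "\<dots> = 3 * 3 ^ (d - 1)" using degree_pos by (cases d) auto
  finally show "card (range ?L) = card {w. Tr w = 0}" using card_trace_fibre[of 0] by simp
qed (auto simp: Tr_diff Tr_cube)

lemma artin_schreier_solution:
  assumes "Tr c = 0"
  obtains z where "z ^ 3 - z = c"
proof -
  have "c \<in> range (\<lambda>z. z ^ 3 - z)" using assms by (simp add: range_artin_schreier)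
  then show ?thesis using that by (elim rangeE) simp
qed

text \<open>The argument z^3 - z + c runs through the trace fibre of c and takes each of its
  elements three times.\<close>

lemma sum_artin_schreier:
  fixes f :: "'a \<Rightarrow> int"
  shows "(\<Sum>z\<in>UNIV. f (z ^ 3 - z + c)) = 3 * (\<Sum>w | Tr w = Tr c. f w)"
proof -
  let ?g = "\<lambda>z. z ^ 3 - z + c"
  have "(\<Sum>z\<in>UNIV. f (?g z)) = (\<Sum>w | Tr w = Tr c. \<Sum>z | ?g z = w. f (?g z))"
    using sum.group[of "UNIV::'a set" "{w. Tr w = Tr c}" ?g "\<lambda>z. f (?g z)"]
    by (simp add: image_subset_iff Tr_add Tr_diff Tr_cube)
  also have "\<dots> = (\<Sum>w | Tr w = Tr c. 3 * f w)"
  proof (rule sum.cong)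
    fix w assume "w \<in> {w. Tr w = Tr c}"
    then have "Tr (w - c) = 0" by (simp add: Tr_diff)
    then obtain y where y: "y ^ 3 - y = w - c" by (rule artin_schreier_solution)
    have "{z. ?g z = w} = {z. z ^ 3 - z = y ^ 3 - y}" unfolding y by (auto simp: eq_diff_eq)
    then have "card {z. ?g z = w} = 3" by (simp only: card_artin_schreier_fibre)
    then show "(\<Sum>z | ?g z = w. f (?g z)) = 3 * f w" by simp
  qed simp
  finally show ?thesis by (simp add: sum_distrib_left)
qed

section \<open>Powers of the primitive root and squares\<close>

lemma \<beta>_neq_0: "\<beta> \<noteq> 0"
proof -
  have "\<beta> ^ 1 \<in> range (\<lambda>n. \<beta> ^ n)" by (rule rangeI)
  then show ?thesis using primitive unfolding primitive_root_def by simp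
qed

lemma power_of_\<beta>:
  assumes "(x::'a) \<noteq> 0"
  obtains k where "x = \<beta> ^ k"
proof -
  have "x \<in> range (\<lambda>n. \<beta> ^ n)"
    using primitive assms unfolding primitive_root_def by simp
  then show ?thesis using that by (elim rangeE)
qed

text \<open>Otherwise every element would be a square, and squaring, surjective on a finite set,
  would be injective; but 1 and -1 have the same square.\<close>

lemma \<beta>_not_square: "\<beta> \<noteq> y ^ 2"
proof
  assume y: "\<beta> = y ^ 2"
  have "\<exists>v. x = v ^ 2" for x :: 'a
  proof (cases "x = 0")
    case False
    then obtain k where "x = \<beta> ^ k" by (rule power_of_\<beta>)
    then have "x = (y ^ k) ^ 2" by (simp add: y mult.commute flip: power_mult)
    then show ?thesis by blast
  qed (auto intro: exI[of _ 0])
  then have "surj (\<lambda>v::'a. v ^ 2)" by (auto simp: surj_def)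
  then have "inj (\<lambda>v::'a. v ^ 2)" by (rule finite_UNIV_surj_inj[OF finite])
  then have "(1::'a) = - 1" by (rule injD) simp
  then show False using one_neq_minus_one by simp
qed

lemma quad_char_power: "quad_char (\<beta> ^ k) = (- 1) ^ k"
proof (cases "even k")
  case True
  then obtain j where "k = 2 * j" by blast
  then have "\<beta> ^ k = (\<beta> ^ j) ^ 2" by (simp add: mult.commute flip: power_mult)
  then show ?thesis using True \<beta>_neq_0 by (simp add: quad_char_square)
next
  case False
  then obtain j where j: "k = 2 * j + 1" using oddE by blast
  have "\<beta> ^ k \<noteq> y ^ 2" for y
  proof
    assume y: "\<beta> ^ k = y ^ 2"
    \<comment> \<open>An odd power is \<beta> times a nonzero square, so if it were a square then
      \<beta> would be one too.\<close>
    have "\<beta> ^ k = \<beta> * (\<beta> ^ j) ^ 2" by (simp add: j mult.commute flip: power_mult)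
    then have "\<beta> = (y / \<beta> ^ j) ^ 2" using y \<beta>_neq_0 by (simp add: field_simps)
    then show False using \<beta>_not_square by blast
  qed
  then show ?thesis using False \<beta>_neq_0 by (simp add: quad_char_def)
qed

lemma quad_char_mult: "quad_char (x * y) = quad_char x * quad_char (y::'a)"
proof (cases "x = 0 \<or> y = 0")
  case False
  then obtain j k where "x = \<beta> ^ j" "y = \<beta> ^ k" using power_of_\<beta> by metis
  then show ?thesis by (simp only: quad_char_power flip: power_add)
qed (auto simp: quad_char_def)

lemma quad_char_\<beta>: "quad_char \<beta> = - 1"
  using quad_char_power[of 1] by simp

text \<open>Here the evenness of d enters: q = 9^e is 1 modulo 4, so the power of \<beta> with
  exponent (q - 1) / 4 squares to -1.\<close>

lemma minus_one_square:
  obtains i where "i ^ 2 = (- 1::'a)"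
proof -
  obtain e where e: "d = 2 * e" using even_degree by blast
  have "3 ^ (2 * e) mod 4 = (1::nat)"
    by (simp add: power_mult flip: power_mod)
  then obtain m where m: "3 ^ d = 4 * m + (1::nat)"
    unfolding e by (metis mult_div_mod_eq)
  have "m > 0" using m degree_pos by (cases m) (auto simp: e)
  \<comment> \<open>The order of \<beta> is at least q - 1: if \<open>\<beta> ^ n = 1\<close>, the
    exponents below n already produce all nonzero elements.\<close>
  have min: "3 ^ d - 1 \<le> n" if "\<beta> ^ n = 1" "n > 0" for n
  proof -
    have "\<beta> ^ k = \<beta> ^ (k mod n)" for k
    proof -
      have "\<beta> ^ k = \<beta> ^ (n * (k div n) + k mod n)" by simp
      then show ?thesis by (simp only: power_add power_mult that power_one mult_1)
    qed
    then have "UNIV - {0} \<subseteq> (\<lambda>k. \<beta> ^ k) ` {..<n}"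
      using power_of_\<beta> that(2) by (metis DiffD2 imageI insertCI lessThan_iff mod_less_divisor subsetI)
    then have "card (UNIV - {0::'a}) \<le> card {..<n}" by (rule surj_card_le[rotated]) simp
    then show ?thesis by (simp add: card_field card_Diff_singleton)
  qed
  \<comment> \<open>The exponent is half of q - 1, so this power is a square root of 1 other than
    1.\<close>
  have "\<beta> ^ (2 * m) \<noteq> 1" using min[of "2 * m"] m \<open>m > 0\<close> by auto
  moreover have "(\<beta> ^ (2 * m)) ^ 2 = 1"
  proof -
    have "\<beta> * \<beta> ^ (4 * m) = \<beta>" using power_CARD[of \<beta>] by (simp add: card_field m)
    then show ?thesis using \<beta>_neq_0 by (simp add: mult.commute flip: power_mult)
  qed
  ultimately have "\<beta> ^ (2 * m) = - 1" unfolding power2_eq_1_iff by blast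
  then have "(\<beta> ^ m) ^ 2 = - 1" by (simp add: mult.commute flip: power_mult)
  then show ?thesis by (rule that)
qed

lemma quad_char_minus: "quad_char (- x) = quad_char (x::'a)"
proof -
  obtain i where i: "i ^ 2 = (- 1::'a)" by (rule minus_one_square)
  then have "i \<noteq> 0" by auto
  then have "quad_char (- 1::'a) = 1" using quad_char_square[of i] i by simp
  then show ?thesis using quad_char_mult[of "- 1" x] by simp
qed

text \<open>Multiplication by the nonsquare \<beta> permutes the field and reverses the sign of the
  sum.\<close>

lemma sum_quad_char: "(\<Sum>x\<in>UNIV. quad_char (x::'a)) = 0"
proof -
  have "(\<Sum>x\<in>UNIV. quad_char (\<beta> * x)) = (\<Sum>x\<in>UNIV. quad_char (x::'a))"
    by (rule sum.reindex_bij_witness[of _ "\<lambda>x. x / \<beta>" "\<lambda>x. \<beta> * x"]) (use \<beta>_neq_0 in auto)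
  then show ?thesis by (simp add: quad_char_mult quad_char_\<beta> sum_negf)
qed

section \<open>Character sums over trace fibres\<close>

definition trace_sum :: "'a \<Rightarrow> int" where
  "trace_sum t = (\<Sum>w | Tr w = t. quad_char w)"

lemma trace_sum_minus: "trace_sum (- t) = trace_sum t"
  unfolding trace_sum_def
  by (rule sum.reindex_bij_witness[of _ uminus uminus]) (auto simp: Tr_minus quad_char_minus)

text \<open>The sum runs over \<open>3 ^ (d - 1)\<close> nonzero elements, an odd number of signs.\<close>

lemma trace_sum_1_neq_0: "trace_sum 1 \<noteq> 0"
proof -
  have "even (\<Sum>w | Tr w = 1. quad_char w - 1)"
    by (rule dvd_sum) (auto simp: quad_char_def)
  moreover have "card {w. Tr w = 1} = 3 ^ (d - 1)"
    using card_trace_fibre[of \<alpha>] by (simp add: trace_\<alpha>)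
  ultimately have "even (trace_sum 1 - 3 ^ (d - 1))"
    by (simp add: trace_sum_def sum_subtractf)
  then show ?thesis by auto
qed

text \<open>The three fibres together contribute 0, and those of 1 and -1 contribute
  equally.\<close>

lemma trace_sum_0: "trace_sum 0 = - 2 * trace_sum 1"
  using sum_by_trace[of quad_char] sum_quad_char trace_sum_minus[of 1] by (simp add: trace_sum_def)

lemma trace_sum_Tr: "Tr x \<noteq> 0 \<Longrightarrow> trace_sum (Tr x) = trace_sum 1"
  using Tr_cases[of x] trace_sum_minus[of 1] by auto

section \<open>Character sums of curves\<close>

lemma char_sum_nonsquare:
  assumes "\<nexists>s. s ^ 2 = - (a4::'a)"
  shows "char_sum a4 a6 = 0"
proof -
  let ?f = "\<lambda>x. x ^ 3 + a4 * x + a6"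
  have "inj ?f"
  proof (rule injI)
    fix x y assume "?f x = ?f y"
    \<comment> \<open>By additivity x - y lies in the kernel, whose nonzero elements would be square
      roots of \<open>- a4\<close>.\<close>
    then have "(x - y) ^ 3 + a4 * (x - y) = 0" by (simp add: cube_diff algebra_simps)
    then have "(x - y) * ((x - y) ^ 2 + a4) = 0"
      by (simp add: algebra_simps power3_eq_cube power2_eq_square)
    moreover have "(x - y) ^ 2 + a4 \<noteq> 0"
      using assms by (simp only: eq_neg_iff_add_eq_0) blast
    ultimately show "x = y" by simp
  qed
  then have "bij ?f" using finite_UNIV_inj_surj[OF finite] by (simp add: bij_def)
  then have "char_sum a4 a6 = (\<Sum>x\<in>UNIV. quad_char (x::'a))"
    unfolding char_sum_def by (rule sum.reindex_bij_betw)
  then show ?thesis by (simp add: sum_quad_char)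
qed

lemma char_sum_square:
  assumes s: "s ^ 2 = - a4" "s \<noteq> 0"
  shows "char_sum a4 a6 = 3 * quad_char s * trace_sum (Tr (a6 * inverse (s ^ 3)))"
proof -
  have a4: "a4 = - (s ^ 2)" using s by simp
  let ?c = "a6 * inverse (s ^ 3)"
  have "char_sum a4 a6 = (\<Sum>z\<in>UNIV. quad_char ((s * z) ^ 3 + a4 * (s * z) + a6))"
    unfolding char_sum_def
    by (rule sum.reindex_bij_witness[of _ "\<lambda>z. s * z" "\<lambda>x. x / s"]) (use s in auto)
  also have "\<dots> = (\<Sum>z\<in>UNIV. quad_char s * quad_char (z ^ 3 - z + ?c))"
  proof (rule sum.cong)
    fix z
    \<comment> \<open>The substitution turns x^3 - s^2 x into s^3 (z^3 - z); the factor s^2 has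
      character 1, so only s contributes a sign.\<close>
    have "(s * z) ^ 3 + a4 * (s * z) + a6 = s ^ 2 * (s * (z ^ 3 - z + ?c))"
      using s(2) by (simp add: a4 field_simps power3_eq_cube power2_eq_square)
    then show "quad_char ((s * z) ^ 3 + a4 * (s * z) + a6) = quad_char s * quad_char (z ^ 3 - z + ?c)"
      using quad_char_square[OF s(2)] by (simp only: quad_char_mult mult_1)
  qed simp
  also have "\<dots> = quad_char s * (\<Sum>z\<in>UNIV. quad_char (z ^ 3 - z + ?c))"
    by (simp add: sum_distrib_left)
  finally show ?thesis by (simp only: sum_artin_schreier trace_sum_def mult.assoc mult.left_commute)
qed

lemma isomorphic_char_sum:
  assumes "isomorphic_curves (a4, a6) (a4', a6' :: 'a)"
  shows "char_sum a4 a6 = char_sum a4' a6'"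
  using isomorphic_card_affine_points[OF assms] card_affine_points[OF two_neq_0] by (metis add_left_cancel)


subsection \<open>Curves of type II\<close>

text \<open>Given a square root s of \<open>- a4\<close>, type II means that s is a nonsquare. Up to
  the factor \<open>trace_sum 1\<close>, the sum is then 6 or -3, against -6 or 3 for a square s and
  0 without any s; these values are distinct as the factor is nonzero.\<close>

lemma type_II_iff_char_sum:
  assumes "(a4::'a) \<noteq> 0"
  shows "type_II (a4, a6) \<longleftrightarrow> char_sum a4 a6 \<in> {6 * trace_sum 1, - 3 * trace_sum 1}"
proof (cases "\<exists>s. s ^ 2 = - a4")
  case False
  then have "\<not> type_II (a4, a6)" by (auto simp: type_II_def)
  then show ?thesis using char_sum_nonsquare[OF False] trace_sum_1_neq_0 by simp
next
  case True
  then obtain s where s: "s ^ 2 = - a4" by blast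
  then have s0: "s \<noteq> 0" using assms by auto
  have fourth: "(\<exists>v. v \<noteq> 0 \<and> v ^ 4 = - a4) \<longleftrightarrow> quad_char s = 1"
  proof
    assume "\<exists>v. v \<noteq> 0 \<and> v ^ 4 = - a4"
    then obtain v where v: "v \<noteq> 0" "v ^ 4 = - a4" by blast
    then have "(v ^ 2) ^ 2 = s ^ 2" by (simp add: s flip: power_mult)
    \<comment> \<open>Either sign will do, since s and -s have the same character.\<close>
    then have "s = v ^ 2 \<or> s = - (v ^ 2)" unfolding power2_eq_iff by auto
    then show "quad_char s = 1" using v by (auto simp: quad_char_minus quad_char_square)
  next
    assume "quad_char s = 1"
    then obtain v where v: "s = v ^ 2" by (auto simp: quad_char_def split: if_splits)
    then have "v ^ 4 = - a4" using s by (simp flip: power_mult)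
    then show "\<exists>v. v \<noteq> 0 \<and> v ^ 4 = - a4" using v s0 by auto
  qed
  have "type_II (a4, a6) \<longleftrightarrow> quad_char s \<noteq> 1"
    using assms s s0 fourth by (auto simp: type_II_def)
  moreover have "quad_char s = 1 \<or> quad_char s = - 1" using s0 by (auto simp: quad_char_def)
  moreover have "trace_sum (Tr (a6 * inverse (s ^ 3))) \<in> {- 2 * trace_sum 1, trace_sum 1}"
    using trace_sum_0 trace_sum_Tr by (metis insertCI)
  ultimately show ?thesis
    using char_sum_square[OF s s0, of a6] trace_sum_1_neq_0 by auto
qed

text \<open>The type is read off from the point count, which an isomorphism preserves; smoothness of
  the second curve provides the nonzero \<open>a4'\<close> that the criterion requires.\<close>

lemma type_II_isomorphic:
  assumes "type_II (a4, a6)" "elliptic_curve (a4', a6')" "isomorphic_curves (a4, a6) (a4', a6')"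
  shows "type_II (a4', a6' :: 'a)"
proof -
  have "a4 \<noteq> 0" using assms(1) by (auto simp: type_II_def)
  moreover have "a4' \<noteq> 0" using assms(2) elliptic_curve_char3[OF three_eq_0] by blast
  ultimately show ?thesis
    using assms(1) isomorphic_char_sum[OF assms(3)] by (simp add: type_II_iff_char_sum)
qed

text \<open>With \<open>s ^ 2 = - a4\<close>, both \<beta> and s are nonsquares, so \<beta> / s is a
  square u^2; scaling by this u carries \<open>a4\<close> to -\<beta>^2.\<close>

lemma type_II_normal_form:
  assumes "type_II (a4, a6)"
  obtains u where "u \<noteq> 0" "u ^ 4 = \<beta> ^ 2 * inverse (- a4)"
    "isomorphic_curves (a4, a6) (- (\<beta> ^ 2), u ^ 6 * a6)"
proof -
  obtain s where s: "s \<noteq> 0" "s ^ 2 = - a4" using assms by (auto simp: type_II_def)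
  have "s \<noteq> v ^ 2" for v
  proof
    assume v: "s = v ^ 2"
    then have "v ^ 4 = - a4" "v \<noteq> 0" using s by (auto simp flip: power_mult)
    then show False using assms by (auto simp: type_II_def)
  qed
  then have "quad_char s = - 1" using s by (auto simp: quad_char_def)
  moreover have "quad_char (\<beta> * inverse s) * quad_char s = quad_char \<beta>"
    using s(1) by (simp add: mult.assoc flip: quad_char_mult)
  ultimately have "quad_char (\<beta> * inverse s) = 1" by (simp add: quad_char_\<beta>)
  then obtain u where u: "\<beta> * inverse s = u ^ 2" by (auto simp: quad_char_def split: if_splits)
  have u0: "u \<noteq> 0" using u \<beta>_neq_0 s by auto
  have "u ^ 4 = (u ^ 2) ^ 2" by (simp flip: power_mult)
  then have u4: "u ^ 4 = \<beta> ^ 2 * inverse (- a4)"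
    by (simp add: power_mult_distrib power_inverse flip: u s(2))
  have "a4 \<noteq> 0" using s by auto
  then have "- (\<beta> ^ 2) = u ^ 4 * a4" unfolding u4 by (simp add: mult.assoc)
  then have "isomorphic_curves (a4, a6) (- (\<beta> ^ 2), u ^ 6 * a6)"
    by (intro isomorphic_curvesI[where u = u and r = 0] three_eq_0 u0) auto
  then show ?thesis using that u0 u4 by blast
qed

text \<open>The trace occurring in \<open>char_sum_square\<close> for s = \<beta>. Only its
  vanishing is preserved by isomorphisms; its sign can change.\<close>

abbreviation invariant :: "'a \<Rightarrow> 'a" where
  "invariant b \<equiv> Tr (b * inverse (\<beta> ^ 3))"

section \<open>Isomorphism classes of the normal forms\<close>

lemma char_sum_normal_form:
  "char_sum (- (\<beta> ^ 2)) b = (if invariant b = 0 then 6 else - 3) * trace_sum 1"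
  using char_sum_square[of \<beta> "- (\<beta> ^ 2)" b] \<beta>_neq_0
  by (simp add: quad_char_\<beta> trace_sum_0 trace_sum_Tr)

text \<open>The condition on u keeps the coefficient -\<beta>^2. A shift by r = \<beta> z changes
  the constant term by \<beta>^3 (z^3 - z), that is, by \<beta>^3 times an arbitrary element of
  trace 0.\<close>

lemma isomorphic_translate:
  assumes "u ^ 4 = 1" and "invariant (u ^ 6 * b) = invariant b'"
  shows "isomorphic_curves (- (\<beta> ^ 2), b) (- (\<beta> ^ 2), b')"
proof -
  have "Tr ((u ^ 6 * b - b') * inverse (\<beta> ^ 3)) = 0"
    using assms(2) by (simp add: left_diff_distrib Tr_diff)
  then obtain z where z: "z ^ 3 - z = (u ^ 6 * b - b') * inverse (\<beta> ^ 3)"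
    by (rule artin_schreier_solution)
  have "u ^ 6 * b - b' = \<beta> ^ 3 * (z ^ 3 - z)" unfolding z using \<beta>_neq_0 by simp
  then have "b' = u ^ 6 * b - (\<beta> * z) ^ 3 + \<beta> ^ 2 * (\<beta> * z)"
    by (simp add: algebra_simps power3_eq_cube power2_eq_square)
  then show ?thesis using assms(1)
    by (intro isomorphic_curvesI[where u = u and r = "\<beta> * z"] three_eq_0) auto
qed

lemma isomorphic_normal_forms_iff:
  "isomorphic_curves (- (\<beta> ^ 2), b) (- (\<beta> ^ 2), b') \<longleftrightarrow> (invariant b = 0 \<longleftrightarrow> invariant b' = 0)"
proof
  assume "isomorphic_curves (- (\<beta> ^ 2), b) (- (\<beta> ^ 2), b')"
  then have "char_sum (- (\<beta> ^ 2)) b = char_sum (- (\<beta> ^ 2)) b'"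
    by (rule isomorphic_char_sum)
  then show "invariant b = 0 \<longleftrightarrow> invariant b' = 0"
    \<comment> \<open>The sum is 6 or -3 times the nonzero \<open>trace_sum 1\<close>, according to
      whether the invariant vanishes.\<close>
    using trace_sum_1_neq_0 unfolding char_sum_normal_form by (simp split: if_splits)
next
  assume iff: "invariant b = 0 \<longleftrightarrow> invariant b' = 0"
  \<comment> \<open>The trace takes only the values 0, 1 and -1, so two nonzero traces agree up to
    sign.\<close>
  then consider "invariant b = invariant b'" | "- invariant b = invariant b'"
    using Tr_cases[of "b * inverse (\<beta> ^ 3)"] Tr_cases[of "b' * inverse (\<beta> ^ 3)"] by force
  then show "isomorphic_curves (- (\<beta> ^ 2), b) (- (\<beta> ^ 2), b')"
  proof cases
    case 1
    then show ?thesis by (intro isomorphic_translate[of 1]) auto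
  next
    case 2
    \<comment> \<open>Scaling by a square root i of -1 keeps -\<beta>^2, as i^4 = 1, and negates the
      constant term, as i^6 = -1.\<close>
    obtain i where i: "i ^ 2 = (- 1::'a)" by (rule minus_one_square)
    have "i ^ 4 = (i ^ 2) ^ 2" "i ^ 6 = (i ^ 2) ^ 3" by (simp_all flip: power_mult)
    then have "i ^ 4 = 1" "i ^ 6 = - 1" by (simp_all add: i)
    then show ?thesis using 2 by (intro isomorphic_translate[of i]) (auto simp: Tr_minus)
  qed
qed

lemma invariant_\<alpha>: "invariant (\<alpha> * \<beta> ^ 3) = 1"
  using \<beta>_neq_0 by (simp add: trace_\<alpha> mult.assoc)

lemma card_isomorphism_classes:
  "card (UNIV // {(b, b'). isomorphic_curves (- (\<beta> ^ 2), b) (- (\<beta> ^ 2), b')}) = 2"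
proof -
  let ?Z = "{b. invariant b = 0}"
  have "UNIV // {(b, b'). isomorphic_curves (- (\<beta> ^ 2), b) (- (\<beta> ^ 2), b')} =
      (\<lambda>b. {b'. invariant b = 0 \<longleftrightarrow> invariant b' = 0}) ` UNIV"
    by (auto simp: quotient_def isomorphic_normal_forms_iff Image_def)
  also have "\<dots> = {?Z, - ?Z}"
  proof
    show "range (\<lambda>b. {b'. invariant b = 0 \<longleftrightarrow> invariant b' = 0}) \<subseteq> {?Z, - ?Z}" by auto
    \<comment> \<open>The parameters 0 and \<alpha> \<beta>^3 show that both classes occur.\<close>
    have "invariant 0 = 0" by simp
    then have "?Z = {b'. invariant 0 = 0 \<longleftrightarrow> invariant b' = 0}" by auto
    moreover have "- ?Z = {b'. invariant (\<alpha> * \<beta> ^ 3) = 0 \<longleftrightarrow> invariant b' = 0}"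
      unfolding invariant_\<alpha> by auto
    ultimately show "{?Z, - ?Z} \<subseteq> range (\<lambda>b. {b'. invariant b = 0 \<longleftrightarrow> invariant b' = 0})"
      by blast
  qed
  also have "card \<dots> = 2" by (subst card_2_iff) blast
  finally show ?thesis .
qed

end

theorem mainTheorem3:
  fixes d :: nat and \<alpha> \<beta> a4 a6 :: "'a :: {field, finite}"
  assumes "CARD('a) = 3 ^ d" and "even d"
    and "primitive_root \<beta>"
    and "trace3 d \<alpha> = 1"
    and "elliptic_curve (a4, a6)"
    and "type_II (a4, a6)"
  shows "(\<exists>u. u \<noteq> 0 \<and> u ^ 4 = \<beta> ^ 2 * inverse (- a4) \<and>
            isomorphic_curves (a4, a6) (- (\<beta> ^ 2), u ^ 6 * a6)) \<and>
         (\<forall>a4' a6'. elliptic_curve (a4', a6') \<and> isomorphic_curves (a4, a6) (a4', a6') \<longrightarrow>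
            type_II (a4', a6')) \<and>
         card (UNIV // {(b, b'). isomorphic_curves (- (\<beta> ^ 2), b) (- (\<beta> ^ 2), b')}) = 2 \<and>
         (\<forall>b. trace3 d (b * inverse (\<beta> ^ 3)) = 0 \<longrightarrow>
            isomorphic_curves (- (\<beta> ^ 2), b) (- (\<beta> ^ 2), 0)) \<and>
         (\<forall>b. trace3 d (b * inverse (\<beta> ^ 3)) \<noteq> 0 \<longrightarrow>
            isomorphic_curves (- (\<beta> ^ 2), b) (- (\<beta> ^ 2), \<alpha> * \<beta> ^ 3))"
proof -
  interpret char3_field d \<alpha> \<beta> using assms by unfold_locales
  show ?thesis
  proof (intro conjI allI impI)
    show "\<exists>u. u \<noteq> 0 \<and> u ^ 4 = \<beta> ^ 2 * inverse (- a4) \<and>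
        isomorphic_curves (a4, a6) (- (\<beta> ^ 2), u ^ 6 * a6)"
      by (rule type_II_normal_form[OF assms(6)]) blast
    show "type_II (a4', a6')"
      if "elliptic_curve (a4', a6') \<and> isomorphic_curves (a4, a6) (a4', a6')" for a4' a6'
      using type_II_isomorphic[OF assms(6)] that by blast
  \<comment> \<open>The two representatives have invariants 0 and 1, so both cases are instances of
    the isomorphism criterion.\<close>
  qed (use card_isomorphism_classes in
      \<open>simp_all add: isomorphic_normal_forms_iff invariant_\<alpha>\<close>)
qed

end
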